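(* Let $\mathscr{L}$ be a countable relational language and $\mathbf{K}$ an $\mathscr{L}$-age. If $\mathbf{K}$ has the $2$-sunflower property, then $\mathbf{K}$ is indivisible at $\mathcal{A}$ whenever $\mathcal{A}\in\mathbf{K}$ with $|A|>2$.
   Context: All relation symbols have finite arity. Script letters denote structures, Roman letters their underlying sets; $[n]=\{0,\dots,n-1\}$. An $\mathscr{L}$-age is a collection of finite $\mathscr{L}$-structures closed under isomorphism. A set $Y$ of finite sets is a sunflower if there is a set $r$ such that $p\cap q=r$ for all distinct $p,q\in Y$. $\mathbf{K}$ has the $2$-sunflower property if for every $\mathcal{A}\in\mathbf{K}$ there is $\mathcal{B}\in\mathbf{K}$ such that whenever $\mathcal{B}'\cong\mathcal{B}$ and all elements of $B'$ are sets of size $2$, there is a substructure $\mathcal{A}'\subseteq\mathcal{B}'$ with $\mathcal{A}'\cong\mathcal{A}$ and $A'$ a sunflower. $\mathbf{K}$ is indivisible at $\mathcal{A}\in\mathbf{K}$ if for all $n\in\omega$ there is $\mathcal{B}\in\mathbf{K}$ such that for every map $\alpha:B\to[n+1]$ there is a substructure $\mathcal{A}^+\subseteq\mathcal{B}$ with $\mathcal{A}^+\cong\mathcal{A}$ and $|\alpha[A^+]|=1$. *)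

theory Defs
  imports Main "HOL-Library.Countable_Set" "HOL-Library.FuncSet" "HOL-Library.Infinite_Typeclass"
begin

text \<open>The symbols form a set rather than a whole type, so that the empty language is included.
  Nullary symbols are allowed.\<close>

record 'r language =
  symbols :: "'r set"
  arity :: "'r \<Rightarrow> nat"

record ('a, 'r) struct =
  universe :: "'a set"
  interp :: "'r \<Rightarrow> 'a list set"

text \<open>Interpretations are empty outside the language, so that equality of structures
  is not affected by junk values.\<close>

definition is_structure :: "'r language \<Rightarrow> ('a, 'r) struct \<Rightarrow> bool" where
  "is_structure L M \<longleftrightarrow>
     (\<forall>R\<in>symbols L. \<forall>xs\<in>interp M R. length xs = arity L R \<and> set xs \<subseteq> universe M) \<and>
     (\<forall>R. R \<notin> symbols L \<longrightarrow> interp M R = {})"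

definition is_iso :: "'r language \<Rightarrow> ('a \<Rightarrow> 'b) \<Rightarrow> ('a, 'r) struct \<Rightarrow> ('b, 'r) struct \<Rightarrow> bool" where
  "is_iso L f M N \<longleftrightarrow>
     bij_betw f (universe M) (universe N) \<and>
     (\<forall>R\<in>symbols L. \<forall>xs. set xs \<subseteq> universe M \<and> length xs = arity L R \<longrightarrow>
        (xs \<in> interp M R \<longleftrightarrow> map f xs \<in> interp N R))"

definition isomorphic :: "'r language \<Rightarrow> ('a, 'r) struct \<Rightarrow> ('b, 'r) struct \<Rightarrow> bool" where
  "isomorphic L M N \<longleftrightarrow> is_structure L M \<and> is_structure L N \<and> (\<exists>f. is_iso L f M N)"

definition substructure :: "'r language \<Rightarrow> ('a, 'r) struct \<Rightarrow> ('a, 'r) struct \<Rightarrow> bool" where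
  "substructure L M N \<longleftrightarrow>
     is_structure L M \<and> is_structure L N \<and> universe M \<subseteq> universe N \<and>
     (\<forall>R\<in>symbols L. \<forall>xs. set xs \<subseteq> universe M \<and> length xs = arity L R \<longrightarrow>
        (xs \<in> interp M R \<longleftrightarrow> xs \<in> interp N R))"

text \<open>An isomorphism-closed collection of finite structures is a proper class; it is represented
  by its members whose points lie in a fixed type of points. When that type is infinite, every
  finite structure has an isomorphic copy there, so the collection is determined by these members.\<close>

definition age :: "'r language \<Rightarrow> ('a::infinite, 'r) struct set \<Rightarrow> bool" where
  "age L K \<longleftrightarrow>
     (\<forall>M\<in>K. is_structure L M \<and> finite (universe M)) \<and>
     (\<forall>M\<in>K. \<forall>N. isomorphic L M N \<longrightarrow> N \<in> K)"

definition sunflower :: "'a set set \<Rightarrow> bool" where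
  "sunflower Y \<longleftrightarrow>
     (\<forall>p\<in>Y. finite p) \<and> (\<exists>r. \<forall>p\<in>Y. \<forall>q\<in>Y. p \<noteq> q \<longrightarrow> p \<inter> q = r)"

text \<open>The copy \<open>B'\<close> has sets of points as its points, hence lives over the type \<open>'a set\<close>.
  Since \<open>B'\<close> is finite, only finitely many elements occur in its points, so for infinite \<open>'a\<close>
  quantifying over \<open>'a set\<close> covers all families of two-element sets up to renaming of elements,
  which does not affect being a sunflower.\<close>

definition two_sunflower_property ::
    "'r language \<Rightarrow> ('a::infinite, 'r) struct set \<Rightarrow> bool" where
  "two_sunflower_property L K \<longleftrightarrow>
     (\<forall>A\<in>K. \<exists>B\<in>K. \<forall>B' :: ('a set, 'r) struct.
        isomorphic L B' B \<and> (\<forall>p\<in>universe B'. card p = 2) \<longrightarrow>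
        (\<exists>A'. substructure L A' B' \<and> isomorphic L A' A \<and> sunflower (universe A')))"

definition indivisible_at ::
    "'r language \<Rightarrow> ('a::infinite, 'r) struct set \<Rightarrow> ('a, 'r) struct \<Rightarrow> bool" where
  "indivisible_at L K A \<longleftrightarrow>
     (\<forall>n::nat. \<exists>B\<in>K. \<forall>\<alpha> \<in> universe B \<rightarrow> {0..<n + 1}.
        \<exists>A'. substructure L A' B \<and> isomorphic L A' A \<and> card (\<alpha> ` universe A') = 1)"

end

(* Attach to each point b of a finite structure the two-element set {b, c}, where c is a new
   element that depends only on the colour of b. Two such sets meet exactly when the colours
   agree, so a sunflower with more than two members of two colours in all is monochromatic.
   The 2-sunflower property therefore gives indivisibility for two colours, and more colours are
   reduced to two by merging all but one of them. *)
theory Submission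
  imports Defs
begin

text \<open>A copy of one structure inside another is treated as a map rather than as a substructure
  with an isomorphism, because maps compose: the merging of colours nests a copy of A in a copy of
  B. \<open>is_structure\<close> is left out and supplied where it matters.\<close>

definition embedding :: "'r language \<Rightarrow> ('a \<Rightarrow> 'b) \<Rightarrow> ('a, 'r) struct \<Rightarrow> ('b, 'r) struct \<Rightarrow> bool" where
  "embedding L f M N \<longleftrightarrow>
     inj_on f (universe M) \<and> f ` universe M \<subseteq> universe N \<and>
     (\<forall>R\<in>symbols L. \<forall>xs. set xs \<subseteq> universe M \<and> length xs = arity L R \<longrightarrow>
        (xs \<in> interp M R \<longleftrightarrow> map f xs \<in> interp N R))"

definition image_struct :: "('a \<Rightarrow> 'b) \<Rightarrow> ('a, 'r) struct \<Rightarrow> ('b, 'r) struct" where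
  "image_struct f M = \<lparr>universe = f ` universe M, interp = (\<lambda>R. map f ` interp M R)\<rparr>"

lemma universe_image_struct [simp]: "universe (image_struct f M) = f ` universe M"
  by (simp add: image_struct_def)

lemma embedding_id: "embedding L id M M"
  by (simp add: embedding_def)

lemma embedding_comp:
  assumes f: "embedding L f M N" and g: "embedding L g N P"
  shows "embedding L (g \<circ> f) M P"
  unfolding embedding_def
proof (intro conjI ballI allI impI)
  have sub: "f ` universe M \<subseteq> universe N" using f by (simp add: embedding_def)
  show "inj_on (g \<circ> f) (universe M)"
    using f g sub by (auto simp: embedding_def intro: comp_inj_on inj_on_subset)
  show "(g \<circ> f) ` universe M \<subseteq> universe P"
    using f g by (fastforce simp: embedding_def)
  fix R xs
  assume R: "R \<in> symbols L" and xs: "set xs \<subseteq> universe M \<and> length xs = arity L R"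
  have "set (map f xs) \<subseteq> universe N \<and> length (map f xs) = arity L R"
    using xs sub by auto
  then have "map f xs \<in> interp N R \<longleftrightarrow> map g (map f xs) \<in> interp P R"
    using g R unfolding embedding_def by blast
  moreover have "xs \<in> interp M R \<longleftrightarrow> map f xs \<in> interp N R"
    using f R xs unfolding embedding_def by blast
  ultimately show "xs \<in> interp M R \<longleftrightarrow> map (g \<circ> f) xs \<in> interp P R"
    by simp
qed

lemma is_iso_imp_embedding: "is_iso L f M N \<Longrightarrow> embedding L f M N"
  unfolding is_iso_def embedding_def bij_betw_def by blast

lemma substructure_imp_embedding: "substructure L M N \<Longrightarrow> embedding L id M N"
  unfolding substructure_def embedding_def by simp

lemma is_iso_inv_into:
  assumes f: "is_iso L f M N"
  shows "is_iso L (inv_into (universe M) f) N M"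
  unfolding is_iso_def
proof (intro conjI ballI allI impI)
  let ?g = "inv_into (universe M) f"
  have bij: "bij_betw f (universe M) (universe N)" using f by (simp add: is_iso_def)
  then show bij': "bij_betw ?g (universe N) (universe M)" by (rule bij_betw_inv_into)
  fix R ys
  assume R: "R \<in> symbols L" and ys: "set ys \<subseteq> universe N \<and> length ys = arity L R"
  have "set (map ?g ys) \<subseteq> universe M \<and> length (map ?g ys) = arity L R"
    using ys bij' by (auto simp: bij_betw_def)
  then have "map ?g ys \<in> interp M R \<longleftrightarrow> map f (map ?g ys) \<in> interp N R"
    using f R unfolding is_iso_def by blast
  moreover have "map f (map ?g ys) = ys"
    using ys bij by (auto simp: bij_betw_inv_into_right subset_eq intro!: map_idI)
  ultimately show "ys \<in> interp N R \<longleftrightarrow> map ?g ys \<in> interp M R"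
    by simp
qed

lemma isomorphic_sym: "isomorphic L M N \<Longrightarrow> isomorphic L N M"
  unfolding isomorphic_def using is_iso_inv_into by blast

lemma is_structure_image_struct:
  "is_structure L M \<Longrightarrow> is_structure L (image_struct f M)"
  by (auto simp: is_structure_def image_struct_def)

lemma is_iso_image_struct:
  assumes M: "is_structure L M" and inj: "inj_on f (universe M)"
  shows "is_iso L f M (image_struct f M)"
  unfolding is_iso_def
proof (intro conjI ballI allI impI)
  show "bij_betw f (universe M) (universe (image_struct f M))"
    using inj by (simp add: bij_betw_def)
  fix R xs
  assume R: "R \<in> symbols L" and xs: "set xs \<subseteq> universe M \<and> length xs = arity L R"
  \<comment> \<open>\<open>map f xs\<close> could also lie in the image relation as the image of
    another related tuple. \<open>is_structure\<close> keeps that tuple inside the universe, where f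
    is injective, so it is xs itself.\<close>
  have "xs = ys" if "ys \<in> interp M R" "map f xs = map f ys" for ys
  proof -
    have "set ys \<subseteq> universe M" using M R that by (auto simp: is_structure_def)
    then have "inj_on f (set xs \<union> set ys)" using xs by (intro inj_on_subset[OF inj]) auto
    with that show ?thesis by (simp add: inj_on_map_eq_map)
  qed
  then show "xs \<in> interp M R \<longleftrightarrow> map f xs \<in> interp (image_struct f M) R"
    unfolding image_struct_def by (simp add: image_iff) blast
qed

lemma isomorphic_image_struct:
  "is_structure L M \<Longrightarrow> inj_on f (universe M) \<Longrightarrow> isomorphic L M (image_struct f M)"
  unfolding isomorphic_def using is_structure_image_struct is_iso_image_struct by blast

text \<open>Leads back from embeddings to the substructures that indivisibility asks for. Each tuple
  over the image lifts to one over the universe of M, where the isomorphism onto the image and the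
  embedding can be compared.\<close>

lemma substructure_image_struct:
  assumes M: "is_structure L M" and N: "is_structure L N" and f: "embedding L f M N"
  shows "substructure L (image_struct f M) N"
  unfolding substructure_def
proof (intro conjI ballI allI impI)
  show "is_structure L (image_struct f M)" using M by (rule is_structure_image_struct)
  show "universe (image_struct f M) \<subseteq> universe N" using f by (simp add: embedding_def)
  fix R ys
  assume R: "R \<in> symbols L"
    and ys: "set ys \<subseteq> universe (image_struct f M) \<and> length ys = arity L R"
  have "ys \<in> lists (f ` universe M)" using ys by auto
  then obtain xs where xs: "set xs \<subseteq> universe M" "ys = map f xs"
    by (auto simp: lists_image)
  have "is_iso L f M (image_struct f M)"
    using M f by (intro is_iso_image_struct) (auto simp: embedding_def)
  then have "ys \<in> interp (image_struct f M) R \<longleftrightarrow> xs \<in> interp M R"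
    using R xs ys unfolding is_iso_def by (metis length_map)
  also have "\<dots> \<longleftrightarrow> ys \<in> interp N R"
    using f R xs ys unfolding embedding_def by (metis length_map)
  finally show "ys \<in> interp (image_struct f M) R \<longleftrightarrow> ys \<in> interp N R" .
qed (rule N)

text \<open>The image is recorded exactly, since being a sunflower concerns the universe of the
  given copy and has to survive the passage to maps.\<close>

lemma embedding_of_copy:
  assumes "substructure L M' N" and "isomorphic L M' M"
  obtains f where "embedding L f M N" and "f ` universe M = universe M'"
proof -
  obtain f where f: "is_iso L f M M'"
    using isomorphic_sym[OF assms(2)] by (auto simp: isomorphic_def)
  show ?thesis
  proof
    show "embedding L f M N"
      using embedding_comp[OF is_iso_imp_embedding[OF f] substructure_imp_embedding[OF assms(1)]]
      by simp
    show "f ` universe M = universe M'"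
      using f by (simp add: is_iso_def bij_betw_def)
  qed
qed

text \<open>If both colours occurred, two pairs of different colours would be disjoint, so the
  kernel would be empty. Two points of the same colour share an element of their pairs, so each
  colour would then occur at most once, leaving at most two points.\<close>

lemma sunflower_two_coloured_constant:
  fixes c :: "bool \<Rightarrow> 'a"
  assumes "inj c" and "range c \<inter> S = {}" and "card S > 2"
    and "sunflower ((\<lambda>b. {b, c (\<beta> b)}) ` S)"
  shows "\<exists>d. \<forall>b\<in>S. \<beta> b = d"
proof (rule ccontr)
  define g where "g b = {b, c (\<beta> b)}" for b
  assume "\<not> ?thesis"
  then obtain x y where xy: "x \<in> S" "y \<in> S" "\<beta> x" "\<not> \<beta> y" by metis
  have fresh: "c d \<noteq> b" if "b \<in> S" for b d using assms(2) that by auto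
  obtain r where "\<forall>p\<in>g ` S. \<forall>q\<in>g ` S. p \<noteq> q \<longrightarrow> p \<inter> q = r"
    using assms(4) unfolding sunflower_def g_def[abs_def] by blast
  then have r: "g p \<inter> g q = r" if "p \<in> S" "q \<in> S" "g p \<noteq> g q" for p q
    using that by blast
  \<comment> \<open>The values of c avoid S, so p is the only point of S in its pair and the pair
    determines p.\<close>
  have ne: "g p \<noteq> g q" if "p \<in> S" "q \<in> S" "p \<noteq> q" for p q
    using that fresh[OF that(1)] by (metis g_def doubleton_eq_iff)
  have same: "c (\<beta> p) \<in> r" if "p \<in> S" "q \<in> S" "p \<noteq> q" "\<beta> p = \<beta> q" for p q
    using r[OF that(1,2) ne[OF that(1-3)]] that(4) by (auto simp: g_def)
  have "x \<noteq> y" using xy by auto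
  have "c (\<beta> x) \<noteq> c (\<beta> y)" using xy injD[OF \<open>inj c\<close>] by blast
  then have "r = {}"
    using r[OF xy(1,2) ne[OF xy(1,2) \<open>x \<noteq> y\<close>]] \<open>x \<noteq> y\<close> fresh[OF xy(1)] fresh[OF xy(2)]
    by (auto simp: g_def)
  then have differ: "\<beta> p \<noteq> \<beta> q" if "p \<in> S" "q \<in> S" "p \<noteq> q" for p q
    using same[OF that] by blast
  \<comment> \<open>A third point z would need a colour different from both values of
    \<open>bool\<close>.\<close>
  have "\<not> S \<subseteq> {x, y}"
    using assms(3) \<open>x \<noteq> y\<close> card_mono[of "{x, y}" S] by auto
  then obtain z where "z \<in> S" "z \<noteq> x" "z \<noteq> y" by blast
  then have "\<beta> z \<noteq> \<beta> x" "\<beta> z \<noteq> \<beta> y" using differ xy by blast+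
  with xy show False by auto
qed

text \<open>B does not depend on the colouring \<beta>: the witness from the sunflower property
  serves all families of pairs at once.\<close>

lemma two_sunflower_two_colours:
  fixes K :: "('a::infinite, 'r) struct set"
  assumes K: "age L K" and sun: "two_sunflower_property L K"
    and A: "A \<in> K" "card (universe A) > 2"
  shows "\<exists>B\<in>K. \<forall>\<beta> :: 'a \<Rightarrow> bool. \<exists>f d. embedding L f A B \<and> (\<forall>x\<in>universe A. \<beta> (f x) = d)"
proof -
  obtain B where B: "B \<in> K" and copy: "\<And>B' :: ('a set, 'r) struct.
      isomorphic L B' B \<Longrightarrow> \<forall>p\<in>universe B'. card p = 2 \<Longrightarrow>
      \<exists>A'. substructure L A' B' \<and> isomorphic L A' A \<and> sunflower (universe A')"
    using sun A(1) unfolding two_sunflower_property_def by blast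
  have strB: "is_structure L B" and finB: "finite (universe B)"
    using K B by (auto simp: age_def)
  \<comment> \<open>The type is infinite and B is finite, so two labels for the colours can be found
    outside B.\<close>
  obtain c0 where c0: "c0 \<notin> universe B"
    using ex_new_if_finite[OF infinite_UNIV finB] by blast
  obtain c1 where c1: "c1 \<notin> insert c0 (universe B)"
    using ex_new_if_finite[OF infinite_UNIV finite.insertI[OF finB]] by blast
  define c where "c d = (if d then c1 else c0)" for d
  have inj_c: "inj c" and fresh: "c d \<notin> universe B" for d
    using c0 c1 by (auto simp: c_def inj_on_def)
  have "\<exists>f d. embedding L f A B \<and> (\<forall>x\<in>universe A. \<beta> (f x) = d)" for \<beta> :: "'a \<Rightarrow> bool"
  proof -
    define g where "g b = {b, c (\<beta> b)}" for b
    have inj_g: "inj_on g (universe B)"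
      using fresh by (auto simp: g_def inj_on_def doubleton_eq_iff)
    let ?B' = "image_struct g B"
    let ?k = "inv_into (universe B) g"
    have "card p = 2" if p: "p \<in> universe ?B'" for p
    proof -
      obtain b where b: "b \<in> universe B" "p = {b, c (\<beta> b)}" using p by (auto simp: g_def)
      then have "b \<noteq> c (\<beta> b)" using fresh by metis
      with b show ?thesis by simp
    qed
    then obtain A' where A': "substructure L A' ?B'" "isomorphic L A' A" "sunflower (universe A')"
      using copy isomorphic_sym[OF isomorphic_image_struct[OF strB inj_g]] by blast
    obtain f where f: "embedding L f A ?B'" and fA: "f ` universe A = universe A'"
      using embedding_of_copy[OF A'(1,2)] .
    \<comment> \<open>Undoing the labelling g turns the sunflower copy of A among the pairs into a
      copy of A in B itself.\<close>
    have kf: "embedding L (?k \<circ> f) A B"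
      using f is_iso_imp_embedding[OF is_iso_inv_into[OF is_iso_image_struct[OF strB inj_g]]]
      by (rule embedding_comp)
    let ?S = "(?k \<circ> f) ` universe A"
    have S: "?S \<subseteq> universe B" and card_S: "card ?S > 2"
      using kf A(2) card_image[of "?k \<circ> f" "universe A"] by (simp_all add: embedding_def)
    have "g ` ?S = universe A'"
    proof -
      have "g (?k p) = p" if "p \<in> universe A'" for p
        using that f fA by (intro f_inv_into_f) (auto simp: embedding_def)
      then show ?thesis unfolding fA[symmetric] by (simp add: image_image)
    qed
    then have "sunflower ((\<lambda>b. {b, c (\<beta> b)}) ` ?S)"
      using A'(3) by (simp add: g_def[abs_def])
    moreover have "range c \<inter> ?S = {}" using S fresh by auto
    ultimately have "\<exists>d. \<forall>b\<in>?S. \<beta> b = d"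
      by (intro sunflower_two_coloured_constant[OF inj_c _ card_S])
    then have "\<exists>d. \<forall>x\<in>universe A. \<beta> ((?k \<circ> f) x) = d" by simp
    with kf show ?thesis by blast
  qed
  with B show ?thesis by blast
qed

text \<open>There are n + 1 colours. In the induction step B handles the first n + 1 of them for A,
  and C handles two colours for B; the two colours are "equal to n + 1" and "at most n".\<close>

lemma two_sunflower_finite_colours:
  fixes K :: "('a::infinite, 'r) struct set" and n :: nat
  assumes K: "age L K" and sun: "two_sunflower_property L K"
    and A: "A \<in> K" "card (universe A) > 2"
  shows "\<exists>B\<in>K. \<forall>\<alpha> \<in> universe B \<rightarrow> {0..<n + 1}.
           \<exists>f d. embedding L f A B \<and> (\<forall>x\<in>universe A. \<alpha> (f x) = d)"
proof (induction n)
  \<comment> \<open>With a single colour A itself serves as B.\<close>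
  case 0
  have "\<exists>f d. embedding L f A A \<and> (\<forall>x\<in>universe A. \<alpha> (f x) = d)"
    if "\<alpha> \<in> universe A \<rightarrow> {0..<0 + 1}" for \<alpha> :: "'a \<Rightarrow> nat"
    using that embedding_id[of L A] by (intro exI[of _ id] exI[of _ 0]) auto
  with A(1) show ?case by blast
next
  case (Suc n)
  then obtain B where B: "B \<in> K" and col: "\<And>\<alpha>. \<alpha> \<in> universe B \<rightarrow> {0..<n + 1} \<Longrightarrow>
      \<exists>f d. embedding L f A B \<and> (\<forall>x\<in>universe A. \<alpha> (f x) = d)" by blast
  \<comment> \<open>A constant colouring shows that A embeds in B. This gives B more than two
    points, as the two-colour lemma requires, and later a copy of A inside a copy of B that has only
    the new colour.\<close>
  obtain e where e: "embedding L e A B" using col[of "\<lambda>_. 0"] by auto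
  have "finite (universe B)" using K B by (auto simp: age_def)
  then have "card (universe A) \<le> card (universe B)"
    using e by (auto simp: embedding_def intro: card_inj_on_le)
  then obtain C where C: "C \<in> K" and two: "\<And>\<beta> :: 'a \<Rightarrow> bool.
      \<exists>f d. embedding L f B C \<and> (\<forall>x\<in>universe B. \<beta> (f x) = d)"
    using two_sunflower_two_colours[OF K sun B] A(2) by auto
  have "\<exists>f d. embedding L f A C \<and> (\<forall>x\<in>universe A. \<alpha> (f x) = d)"
    if \<alpha>: "\<alpha> \<in> universe C \<rightarrow> {0..<Suc n + 1}" for \<alpha>
  proof -
    obtain h d where h: "embedding L h B C"
      and d: "\<forall>x\<in>universe B. (\<alpha> (h x) = n + 1) = d"
      using two[of "\<lambda>x. \<alpha> x = n + 1"] by auto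
    show ?thesis
    proof (cases d)
      case True
      then have "\<forall>x\<in>universe A. \<alpha> ((h \<circ> e) x) = n + 1"
        using d e by (auto simp: embedding_def)
      then show ?thesis using embedding_comp[OF e h] by blast
    next
      case False
      \<comment> \<open>The copy of B avoids the top colour, so pulling \<alpha> back along h gives
        a colouring to which the induction hypothesis applies.\<close>
      have "(\<alpha> \<circ> h) x < n + 1" if "x \<in> universe B" for x
      proof -
        have "h x \<in> universe C" using h that by (auto simp: embedding_def)
        then have "\<alpha> (h x) < Suc n + 1" using \<alpha> by auto
        with d False that show ?thesis by (simp add: less_Suc_eq)
      qed
      then obtain f m where f: "embedding L f A B" and m: "\<forall>x\<in>universe A. (\<alpha> \<circ> h) (f x) = m"
        using col[of "\<alpha> \<circ> h"] by (auto simp: Pi_iff)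
      then have "\<forall>x\<in>universe A. \<alpha> ((h \<circ> f) x) = m" by simp
      then show ?thesis using embedding_comp[OF f h] by blast
    qed
  qed
  with C show ?case by blast
qed

theorem proposition5p2:
  fixes L :: "'r language"
    and K :: "('a::infinite, 'r) struct set"
  assumes "countable (symbols L)"
    and "age L K"
    and "two_sunflower_property L K"
  shows "\<forall>A\<in>K. card (universe A) > 2 \<longrightarrow> indivisible_at L K A"
proof (intro ballI impI)
  fix A assume A: "A \<in> K" "card (universe A) > 2"
  show "indivisible_at L K A"
    unfolding indivisible_at_def
  proof
    fix n :: nat
    obtain B where B: "B \<in> K" and col: "\<And>\<alpha>. \<alpha> \<in> universe B \<rightarrow> {0..<n + 1} \<Longrightarrow>
        \<exists>f d. embedding L f A B \<and> (\<forall>x\<in>universe A. \<alpha> (f x) = d)"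
      using two_sunflower_finite_colours[OF assms(2,3) A, of n] by blast
    have strA: "is_structure L A" and strB: "is_structure L B"
      using assms(2) A B by (auto simp: age_def)
    have "\<exists>A'. substructure L A' B \<and> isomorphic L A' A \<and> card (\<alpha> ` universe A') = 1"
      if \<alpha>: "\<alpha> \<in> universe B \<rightarrow> {0..<n + 1}" for \<alpha>
    proof -
      obtain f d where f: "embedding L f A B" and d: "\<forall>x\<in>universe A. \<alpha> (f x) = d"
        using col[OF \<alpha>] by blast
      \<comment> \<open>A constant colouring of the empty set would have an image of cardinality 0,
        not 1.\<close>
      have "universe A \<noteq> {}" using A(2) by auto
      then have "\<alpha> ` universe (image_struct f A) = {d}" using d by auto
      then have "card (\<alpha> ` universe (image_struct f A)) = 1" by simp
      moreover have "isomorphic L (image_struct f A) A"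
        using f strA by (simp add: embedding_def isomorphic_sym[OF isomorphic_image_struct])
      ultimately show ?thesis
        using substructure_image_struct[OF strA strB f] by blast
    qed
    with B show "\<exists>B\<in>K. \<forall>\<alpha>\<in>universe B \<rightarrow> {0..<n + 1}.
        \<exists>A'. substructure L A' B \<and> isomorphic L A' A \<and> card (\<alpha> ` universe A') = 1" by blast
  qed
qed

end
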